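(* Let $L\ge4$ be an even integer and consider the activity process on the $L\times L$ toric grid with $p=1$ and $\mu=1$, so that $\sigma=\nu>0$. Let $\mathcal S=\{I\in\Omega:\phi(\mathcal E,I)\le L\}$ and let $\partial^-\mathcal S$ be its inner boundary. Then the conductance of $\mathcal S$ satisfies $$\Phi(\mathcal S)\;\le\;\frac{|\partial^-\mathcal S|\,(L^2/2-L)}{\sigma^{L}} .$$
   Context: Toric grid: $G=(V,E)$ with $V=\{1,\dots,L\}^2$, $L$ even, two vertices being adjacent iff they differ by $1\pmod L$ in exactly one coordinate. $\mathcal E$ is the set of vertices with even coordinate sum. $\Omega$ is the collection of independent sets of $G$. Activity process (with $p=\mu=1$): the continuous-time Markov process on $\Omega$ with transition rates $q(I,I\cup\{v\})=\nu=\sigma$ for each $v\notin I$ with $I\cup\{v\}\in\Omega$, $q(I,I\setminus\{v\})=1$ for each $v\in I$, and $q(I,J)=0$ for all other $J\ne I$. Its stationary distribution is $\pi(I)=\sigma^{|I|}/\sum_{J\in\Omega}\sigma^{|J|}$, and $\pi(S)=\sum_{x\in S}\pi(x)$ for $S\subseteq\Omega$. Conductance of $S\subseteq\Omega$: $\Phi(S):=\dfrac{\sum_{x\in S}\sum_{y\in \Omega\setminus S}\pi(x)q(x,y)}{\pi(S)}$. Communication height: $\Delta(I):=L^2/2-|I|$; a path $\omega:I\to I'$ is a finite sequence of elements of $\Omega$ from $I$ to $I'$ in which consecutive sets differ by adding or removing exactly one vertex; $\phi(I,I'):=\min_{\omega:I\to I'}\max_{J\in\omega}\Delta(J)$. The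 inner boundary $\partial^-\mathcal S$ is the set of $I\in\mathcal S$ for which there is $J\in\Omega\setminus\mathcal S$ with $|I\triangle J|=1$. *)

theory Defs
  imports Complex_Main "HOL-Number_Theory.Cong"
begin

section \<open>The toric grid and its independent sets\<close>

definition grid_vertices :: "nat \<Rightarrow> (nat \<times> nat) set" where
  "grid_vertices L = {1..L} \<times> {1..L}"

definition cyclic_adj :: "nat \<Rightarrow> nat \<Rightarrow> nat \<Rightarrow> bool" where
  "cyclic_adj L a b \<longleftrightarrow> [a = b + 1] (mod L) \<or> [b = a + 1] (mod L)"

text \<open>As usual for grids, neighbours agree in the coordinate in which they do not differ by one.\<close>

definition grid_adj :: "nat \<Rightarrow> nat \<times> nat \<Rightarrow> nat \<times> nat \<Rightarrow> bool" where
  "grid_adj L u v \<longleftrightarrow> u \<in> grid_vertices L \<and> v \<in> grid_vertices L \<and>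
     (fst u = fst v \<and> cyclic_adj L (snd u) (snd v) \<or>
      snd u = snd v \<and> cyclic_adj L (fst u) (fst v))"

definition indep_sets :: "nat \<Rightarrow> (nat \<times> nat) set set" where
  "indep_sets L = {I. I \<subseteq> grid_vertices L \<and> (\<forall>u\<in>I. \<forall>v\<in>I. \<not> grid_adj L u v)}"

definition even_vertices :: "nat \<Rightarrow> (nat \<times> nat) set" where
  "even_vertices L = {v \<in> grid_vertices L. even (fst v + snd v)}"


section \<open>The activity process\<close>

text \<open>Off-diagonal transition rates for \<open>p = \<mu> = 1\<close>, for states in \<^term>\<open>indep_sets L\<close>.  The
  diagonal value (here \<open>0\<close>) plays no role.\<close>

definition activity_rate :: "nat \<Rightarrow> real \<Rightarrow> (nat \<times> nat) set \<Rightarrow> (nat \<times> nat) set \<Rightarrow> real" where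
  "activity_rate L \<sigma> I J =
     (if \<exists>v. v \<notin> I \<and> J = insert v I \<and> J \<in> indep_sets L then \<sigma>
      else if \<exists>v\<in>I. J = I - {v} then 1
      else 0)"

definition stationary :: "nat \<Rightarrow> real \<Rightarrow> (nat \<times> nat) set \<Rightarrow> real" where
  "stationary L \<sigma> I = \<sigma> ^ card I / (\<Sum>J\<in>indep_sets L. \<sigma> ^ card J)"

definition conductance ::
    "'a set \<Rightarrow> ('a \<Rightarrow> real) \<Rightarrow> ('a \<Rightarrow> 'a \<Rightarrow> real) \<Rightarrow> 'a set \<Rightarrow> real" where
  "conductance \<Omega> \<pi> q S = (\<Sum>x\<in>S. \<Sum>y\<in>\<Omega> - S. \<pi> x * q x y) / (\<Sum>x\<in>S. \<pi> x)"


section \<open>Paths and communication height\<close>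

definition height :: "nat \<Rightarrow> (nat \<times> nat) set \<Rightarrow> real" where
  "height L I = real L ^ 2 / 2 - real (card I)"

definition config_path ::
    "nat \<Rightarrow> (nat \<times> nat) set \<Rightarrow> (nat \<times> nat) set \<Rightarrow> (nat \<times> nat) set list \<Rightarrow> bool" where
  "config_path L I I' w \<longleftrightarrow> w \<noteq> [] \<and> hd w = I \<and> last w = I' \<and> set w \<subseteq> indep_sets L \<and>
     (\<forall>k. Suc k < length w \<longrightarrow> card (sym_diff (w ! k) (w ! Suc k)) = 1)"

definition comm_height :: "nat \<Rightarrow> (nat \<times> nat) set \<Rightarrow> (nat \<times> nat) set \<Rightarrow> real" where
  "comm_height L I I' = Min {Max (height L ` set w) |w. config_path L I I' w}"

definition inner_boundary :: "nat \<Rightarrow> (nat \<times> nat) set set \<Rightarrow> (nat \<times> nat) set set" where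
  "inner_boundary L S = {I \<in> S. \<exists>J\<in>indep_sets L - S. card (sym_diff I J) = 1}"

definition even_basin :: "nat \<Rightarrow> (nat \<times> nat) set set" where
  "even_basin L = {I \<in> indep_sets L. comm_height L (even_vertices L) I \<le> real L}"


section \<open>Sanity checks\<close>

lemma finite_indep_sets: "finite (indep_sets L)"
proof -
  have "indep_sets L \<subseteq> Pow (grid_vertices L)"
    by (auto simp: indep_sets_def)
  then show ?thesis
    by (rule finite_subset) (simp add: grid_vertices_def)
qed

lemma finite_indep_set: "I \<in> indep_sets L \<Longrightarrow> finite I"
  by (rule finite_subset[of _ "grid_vertices L"]) (auto simp: indep_sets_def grid_vertices_def)

lemma indep_sets_subset: "I \<in> indep_sets L \<Longrightarrow> J \<subseteq> I \<Longrightarrow> J \<in> indep_sets L"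
  unfolding indep_sets_def by blast

lemma even_vertices_indep:
  assumes "even L"
  shows "even_vertices L \<in> indep_sets L"
proof -
  have parity: "even a \<noteq> even b" if "cyclic_adj L a b" for a b
  proof -
    have "[a = b + 1] (mod 2) \<or> [b = a + 1] (mod 2)"
      using that assms unfolding cyclic_adj_def by (metis cong_dvd_modulus_nat)
    then show ?thesis
      by (auto simp: cong_def mod2_eq_if split: if_splits)
  qed
  have "\<not> grid_adj L u v" if "u \<in> even_vertices L" "v \<in> even_vertices L" for u v
    using that parity by (force simp: grid_adj_def even_vertices_def)
  then show ?thesis
    by (auto simp: indep_sets_def even_vertices_def)
qed

text \<open>The minimum defining \<^const>\<open>comm_height\<close> ranges over a finite nonempty set, hence is attained.\<close>

lemma finite_path_heights: "finite {Max (height L ` set w) |w. config_path L I I' w}"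
proof (rule finite_subset)
  show "{Max (height L ` set w) |w. config_path L I I' w} \<subseteq> height L ` indep_sets L"
  proof clarify
    fix w assume w: "config_path L I I' w"
    then have "Max (height L ` set w) \<in> height L ` set w"
      by (intro Max_in) (auto simp: config_path_def)
    then show "Max (height L ` set w) \<in> height L ` indep_sets L"
      using w by (meson config_path_def image_mono subsetD)
  qed
qed (simp add: finite_indep_sets)

lemma config_path_Cons:
  assumes "config_path L J K w" "I \<in> indep_sets L" "card (sym_diff I J) = 1"
  shows "config_path L I K (I # w)"
  using assms by (auto simp: config_path_def nth_Cons hd_conv_nth split: nat.splits)

lemma config_path_snoc:
  assumes "config_path L I J w" "K \<in> indep_sets L" "card (sym_diff J K) = 1"
  shows "config_path L I K (w @ [K])"
proof -
  have "card (sym_diff ((w @ [K]) ! k) ((w @ [K]) ! Suc k)) = 1" if "k < length w" for k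
  proof (cases "Suc k < length w")
    case True
    then show ?thesis using assms by (auto simp: config_path_def nth_append)
  next
    case False
    then have k: "Suc k = length w" using that by simp
    then have "w ! k = J"
      using assms by (metis config_path_def diff_Suc_1 last_conv_nth)
    then show ?thesis using assms k that by (simp add: nth_append)
  qed
  then show ?thesis using assms by (auto simp: config_path_def)
qed

lemma config_path_exists:
  assumes I: "I \<in> indep_sets L" and J: "J \<in> indep_sets L"
  shows "\<exists>w. config_path L I J w"
proof -
  have from_empty: "\<exists>w. config_path L {} J w"
    using finite_indep_set[OF J] J
  proof (induction J rule: finite_induct)
    case empty
    then show ?case by (intro exI[of _ "[{}]"]) (auto simp: config_path_def)
  next
    case (insert v F)
    have "F \<in> indep_sets L"
      using insert.prems by (rule indep_sets_subset) auto
    with insert.IH obtain w where w: "config_path L {} F w" by blast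
    have "sym_diff F (insert v F) = {v}" using insert.hyps by auto
    then have "card (sym_diff F (insert v F)) = 1" by simp
    from config_path_snoc[OF w insert.prems this] show ?case by blast
  qed
  show ?thesis
    using finite_indep_set[OF I] I
  proof (induction I rule: finite_induct)
    case empty
    then show ?case using from_empty by blast
  next
    case (insert v F)
    have "F \<in> indep_sets L"
      using insert.prems by (rule indep_sets_subset) auto
    with insert.IH obtain w where w: "config_path L F J w" by blast
    have "sym_diff (insert v F) F = {v}" using insert.hyps by auto
    then have "card (sym_diff (insert v F) F) = 1" by simp
    from config_path_Cons[OF w insert.prems this] show ?case by blast
  qed
qed

text \<open>\<^const>\<open>stationary\<close> is a probability distribution on \<^const>\<open>indep_sets\<close> that is reversible, hence
  stationary, for the rates \<^const>\<open>activity_rate\<close>.\<close>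

lemma partition_function_pos:
  fixes \<sigma> :: real
  assumes "\<sigma> > 0"
  shows "(\<Sum>J\<in>indep_sets L. \<sigma> ^ card J) > 0"
proof -
  have "{} \<in> indep_sets L" by (simp add: indep_sets_def)
  then show ?thesis
    by (rule sum_pos2[OF finite_indep_sets]) (use assms in auto)
qed

lemma stationary_sum: "\<sigma> > 0 \<Longrightarrow> (\<Sum>I\<in>indep_sets L. stationary L \<sigma> I) = 1"
  using partition_function_pos[of \<sigma> L]
  by (simp add: stationary_def flip: sum_divide_distrib)

lemma stationary_detailed_balance:
  assumes I: "I \<in> indep_sets L" and J: "J \<in> indep_sets L"
  shows "stationary L \<sigma> I * activity_rate L \<sigma> I J = stationary L \<sigma> J * activity_rate L \<sigma> J I"
proof -
  have add: "stationary L \<sigma> A * activity_rate L \<sigma> A B = stationary L \<sigma> B * activity_rate L \<sigma> B A"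
    if A: "A \<in> indep_sets L" and B: "B \<in> indep_sets L" and v: "v \<notin> A" "B = insert v A" for A B v
  proof -
    have "activity_rate L \<sigma> A B = \<sigma>"
      unfolding activity_rate_def using B v by metis
    moreover have "activity_rate L \<sigma> B A = 1"
    proof -
      have "\<nexists>u. u \<notin> B \<and> A = insert u B" "\<exists>u\<in>B. A = B - {u}" using v by auto
      then show ?thesis unfolding activity_rate_def by auto
    qed
    moreover have "card B = Suc (card A)"
      using v finite_indep_set[OF A] by simp
    ultimately show ?thesis by (simp add: stationary_def)
  qed
  consider (1) v where "v \<notin> I" "J = insert v I" | (2) v where "v \<notin> J" "I = insert v J"
    | (3) "\<nexists>v. v \<notin> I \<and> J = insert v I" "\<nexists>v. v \<notin> J \<and> I = insert v J"
    by blast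
  then show ?thesis
  proof cases
    case 1
    then show ?thesis using add[OF I J] by blast
  next
    case 2
    then show ?thesis using add[OF J I] by metis
  next
    case 3
    have "activity_rate L \<sigma> I J = 0" "activity_rate L \<sigma> J I = 0"
      using 3 unfolding activity_rate_def by (metis Diff_iff insert_Diff singletonI)+
    then show ?thesis by simp
  qed
qed

end

theory Submission
  imports Defs
begin

text \<open>A transition leaving the basin must raise the height above \<open>L\<close>. Since the height changes by one
  at each transition, it deletes a vertex, at rate \<open>1\<close>, from a configuration of height exactly \<open>L\<close>.
  So each inner boundary state has size \<open>L\<^sup>2/2 - L\<close>, and contributes at most that many unit rates
  with unnormalized weight \<open>\<sigma>\<close> to the power \<open>L\<^sup>2/2 - L\<close>; the basin weighs at least \<open>\<sigma>\<close> to the power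
  \<open>L\<^sup>2/2\<close>, the weight of the even configuration.\<close>

text \<open>The involution \<open>f\<close> swaps the two columns of each pair {2k-1, 2k}, flipping
  the parity of the coordinate sum. Evenness of \<open>L\<close> means that no column is left
  unpaired, so the two parity classes are equinumerous.\<close>

lemma card_even_vertices:
  assumes "even L"
  shows "2 * card (even_vertices L) = L ^ 2"
proof -
  define O' where "O' = {v \<in> grid_vertices L. odd (fst v + snd v)}"
  define f :: "nat \<times> nat \<Rightarrow> nat \<times> nat"
    where "f = (\<lambda>(a, b). (a, if even b then b - 1 else b + 1))"
  have f: "f v \<in> grid_vertices L \<and> f (f v) = v \<and> (even (fst (f v) + snd (f v)) \<longleftrightarrow> odd (fst v + snd v))"
    if "v \<in> grid_vertices L" for v
    using that assms
    by (cases v) (auto simp: f_def grid_vertices_def elim!: evenE oddE, presburger)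
  have "bij_betw f (even_vertices L) O'"
    by (rule bij_betw_byWitness[where f' = f]) (use f in
      \<open>simp_all add: even_vertices_def O'_def image_subset_iff del: even_add odd_add\<close>)
  then have "card O' = card (even_vertices L)"
    by (simp add: bij_betw_same_card)
  moreover have "card (even_vertices L \<union> O') = card (even_vertices L) + card O'"
    by (rule card_Un_disjoint) (auto simp: even_vertices_def O'_def grid_vertices_def)
  moreover have "even_vertices L \<union> O' = grid_vertices L"
    by (auto simp: even_vertices_def O'_def)
  moreover have "card (grid_vertices L) = L ^ 2"
    by (simp add: grid_vertices_def power2_eq_square)
  ultimately show ?thesis by simp
qed

text \<open>Replacing the half-square by a cardinality shows heights as differences of naturals.
  This integrality is what later pins the exit height to exactly \<open>L\<close>.\<close>

lemma height_conv_card_even: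
  assumes "even L"
  shows "height L I = real (card (even_vertices L)) - real (card I)"
proof -
  have "2 * real (card (even_vertices L)) = real L ^ 2"
    using card_even_vertices[OF assms] by (metis of_nat_mult of_nat_numeral of_nat_power)
  then show ?thesis by (simp add: height_def)
qed

text \<open>Some path exists and only finitely many heights occur, so the minimum is attained and
  basin membership can be handled through a single witnessing path.\<close>

lemma comm_height_le_iff:
  assumes "I \<in> indep_sets L" "J \<in> indep_sets L"
  shows "comm_height L I J \<le> c \<longleftrightarrow> (\<exists>w. config_path L I J w \<and> (\<forall>K\<in>set w. height L K \<le> c))"
proof -
  have "comm_height L I J \<le> c \<longleftrightarrow> (\<exists>w. config_path L I J w \<and> Max (height L ` set w) \<le> c)"
    unfolding comm_height_def
    by (subst Min_le_iff) (use config_path_exists[OF assms] finite_path_heights in auto)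
  also have "\<dots> \<longleftrightarrow> (\<exists>w. config_path L I J w \<and> (\<forall>K\<in>set w. height L K \<le> c))"
    by (rule ex_cong1) (auto simp: config_path_def)
  finally show ?thesis .
qed

lemma even_basin_iff:
  assumes "even L"
  shows "I \<in> even_basin L \<longleftrightarrow> I \<in> indep_sets L \<and>
    (\<exists>w. config_path L (even_vertices L) I w \<and> (\<forall>K\<in>set w. height L K \<le> real L))"
  using comm_height_le_iff[OF even_vertices_indep[OF assms]] by (auto simp: even_basin_def)

lemma even_basin_subset: "even_basin L \<subseteq> indep_sets L"
  by (auto simp: even_basin_def)

lemma even_vertices_in_even_basin:
  assumes "even L"
  shows "even_vertices L \<in> even_basin L"
  unfolding even_basin_iff[OF assms]
  \<comment> \<open>The one-state path works: the even configuration has height 0.\<close>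
  by (intro conjI exI[of _ "[even_vertices L]"])
     (auto simp: config_path_def even_vertices_indep assms height_conv_card_even)

lemma even_basin_height_le:
  assumes "even L" "I \<in> even_basin L"
  shows "height L I \<le> real L"
  using assms by (auto simp: even_basin_iff config_path_def)

text \<open>Appending \<open>J\<close> to a witnessing path for \<open>I\<close> keeps every height
  at most \<open>L\<close>. Its contrapositive constrains all exits from the basin.\<close>

lemma even_basin_step:
  assumes L: "even L" and I: "I \<in> even_basin L" and J: "J \<in> indep_sets L"
    and step: "card (sym_diff I J) = 1" and h: "height L J \<le> real L"
  shows "J \<in> even_basin L"
proof -
  obtain w where w: "config_path L (even_vertices L) I w" "\<forall>K\<in>set w. height L K \<le> real L"
    using I even_basin_iff[OF L] by blast
  have "config_path L (even_vertices L) J (w @ [J])"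
    using config_path_snoc[OF w(1) J step] .
  then show ?thesis
    unfolding even_basin_iff[OF L] using w(2) h J by (intro conjI exI[of _ "w @ [J]"]) auto
qed

lemma even_basin_exit:
  assumes L: "even L" and I: "I \<in> even_basin L" and J: "J \<in> indep_sets L - even_basin L"
    and rate: "activity_rate L \<sigma> I J \<noteq> 0"
  shows "\<exists>v\<in>I. J = I - {v}" and "activity_rate L \<sigma> I J = 1"
    and "card I + L = card (even_vertices L)" and "I \<in> inner_boundary L (even_basin L)"
proof -
  have fin: "finite I"
    using I even_basin_subset finite_indep_set by blast
  \<comment> \<open>An addition lowers the height, so it cannot leave the basin.\<close>
  have no_add: "\<nexists>v. v \<notin> I \<and> J = insert v I"
  proof clarify
    fix v assume v: "v \<notin> I" "J = insert v I"
    then have "sym_diff I J = {v}" by auto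
    moreover have "height L J \<le> real L"
      using even_basin_height_le[OF L I] fin v by (simp add: height_def)
    ultimately show False
      using even_basin_step[OF L I, of J] J by auto
  qed
  then show ex: "\<exists>v\<in>I. J = I - {v}"
    using rate by (auto simp: activity_rate_def split: if_splits)
  show "activity_rate L \<sigma> I J = 1"
    using no_add ex unfolding activity_rate_def by auto
  obtain v where v: "v \<in> I" "J = I - {v}" using ex by blast
  then have "sym_diff I J = {v}" by auto
  then have step: "card (sym_diff I J) = 1" by simp
  then show "I \<in> inner_boundary L (even_basin L)"
    using I J by (auto simp: inner_boundary_def)
  have "height L J > real L"
    using even_basin_step[OF L I _ step] J by force
  moreover have "card I = Suc (card J)"
    using v fin by (metis card.remove)
  \<comment> \<open>\<open>I\<close> has height at most \<open>L\<close>, while \<open>J\<close> is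
    one higher and strictly above \<open>L\<close>; for integers this forces height
    \<open>L\<close>.\<close>
  ultimately show "card I + L = card (even_vertices L)"
    using even_basin_height_le[OF L I] unfolding height_conv_card_even[OF L] by linarith
qed

lemma stationary_pos: "\<sigma> > 0 \<Longrightarrow> stationary L \<sigma> I > 0"
  by (simp add: stationary_def partition_function_pos)

lemma sym_diff_eq_singletonD:
  assumes "sym_diff A B = {v}"
  shows "(v \<notin> A \<and> B = insert v A) \<or> (v \<in> A \<and> B = A - {v})"
proof -
  have mem: "x \<in> B \<longleftrightarrow> (x \<in> A \<longleftrightarrow> x \<noteq> v)" for x
    using arg_cong[OF assms, of "\<lambda>C. x \<in> C"] by auto
  show ?thesis
  proof (cases "v \<in> A")
    case True
    then have "B = A - {v}" using mem by (intro set_eqI) (metis Diff_iff singleton_iff)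
    with True show ?thesis by blast
  next
    case False
    then have "B = insert v A" using mem by (intro set_eqI) (metis insert_iff)
    with False show ?thesis by blast
  qed
qed

text \<open>The weight of a boundary state is expressed relative to that of the even configuration,
  so the partition function never has to be evaluated.\<close>

lemma boundary_flow_le:
  assumes L: "even L" and \<sigma>: "\<sigma> > 0" and I: "I \<in> inner_boundary L (even_basin L)"
  shows "(\<Sum>J\<in>indep_sets L - even_basin L. stationary L \<sigma> I * activity_rate L \<sigma> I J)
    \<le> (real L ^ 2 / 2 - real L) * (stationary L \<sigma> (even_vertices L) / \<sigma> ^ L)"
proof -
  let ?T = "indep_sets L - even_basin L"
  let ?N = "{J \<in> ?T. activity_rate L \<sigma> I J \<noteq> 0}"
  have IS: "I \<in> even_basin L" using I by (simp add: inner_boundary_def)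
  have fin: "finite I" using IS even_basin_subset finite_indep_set by blast
  note exit = even_basin_exit[OF L IS, where \<sigma> = \<sigma>]
  obtain J where J: "J \<in> ?T" "card (sym_diff I J) = 1"
    using I by (auto simp: inner_boundary_def)
  \<comment> \<open>The boundary only supplies a neighbour outside the basin; any such move has rate
    \<open>\<sigma>\<close> or 1, so the exit lemma applies to it.\<close>
  have nz: "activity_rate L \<sigma> I J \<noteq> 0"
  proof -
    from J(2) obtain v where "sym_diff I J = {v}" by (auto simp: card_1_singleton_iff)
    then have "(v \<notin> I \<and> J = insert v I) \<or> (v \<in> I \<and> J = I - {v})"
      by (rule sym_diff_eq_singletonD)
    moreover have "J \<in> indep_sets L" using J(1) by simp
    ultimately show ?thesis
      using \<sigma> unfolding activity_rate_def by (smt (verit))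
  qed
  have card: "card I + L = card (even_vertices L)"
    using exit(3)[OF J(1) nz] .
  have \<pi>: "stationary L \<sigma> I = stationary L \<sigma> (even_vertices L) / \<sigma> ^ L"
    using \<sigma> by (simp add: stationary_def power_add flip: card)
  have rates: "(\<Sum>J\<in>?T. activity_rate L \<sigma> I J) \<le> real (card I)"
  proof -
    have "(\<Sum>J\<in>?T. activity_rate L \<sigma> I J) = (\<Sum>J\<in>?N. 1)"
      by (rule sum.mono_neutral_cong_right) (use exit(2) in \<open>auto simp: finite_indep_sets\<close>)
    also have "\<dots> = real (card ?N)" by simp
    \<comment> \<open>Every exit target is \<open>I - {v}\<close> for some \<open>v\<close> in
      \<open>I\<close>.\<close>
    also have "card ?N \<le> card ((\<lambda>v. I - {v}) ` I)"
      using exit(1) fin by (intro card_mono) blast+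
    also have "\<dots> \<le> card I" using fin by (rule card_image_le)
    finally show ?thesis by simp
  qed
  have "real (card I) = real L ^ 2 / 2 - real L"
    using height_conv_card_even[OF L, of I] by (simp add: height_def flip: card)
  with rates have "(\<Sum>J\<in>?T. activity_rate L \<sigma> I J) \<le> real L ^ 2 / 2 - real L"
    by simp
  then have "stationary L \<sigma> I * (\<Sum>J\<in>?T. activity_rate L \<sigma> I J)
      \<le> stationary L \<sigma> I * (real L ^ 2 / 2 - real L)"
    by (rule mult_left_mono) (rule less_imp_le[OF stationary_pos[OF \<sigma>]])
  then show ?thesis
    unfolding sum_distrib_left \<pi> by (simp only: mult.commute)
qed

theorem lemma3p4:
  fixes L :: nat and \<sigma> :: real
  assumes "L \<ge> 4" and "even L" and "\<sigma> > 0"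
  shows "conductance (indep_sets L) (stationary L \<sigma>) (activity_rate L \<sigma>) (even_basin L)
    \<le> real (card (inner_boundary L (even_basin L))) * (real L ^ 2 / 2 - real L) / \<sigma> ^ L"
proof -
  let ?S = "even_basin L" and ?B = "inner_boundary L (even_basin L)"
  let ?E = "stationary L \<sigma> (even_vertices L)" and ?d = "real L ^ 2 / 2 - real L"
  let ?flow = "\<lambda>I. \<Sum>J\<in>indep_sets L - ?S. stationary L \<sigma> I * activity_rate L \<sigma> I J"
  have fin: "finite ?S" using even_basin_subset finite_indep_sets by (rule finite_subset)
  have d: "?d \<ge> 0"
    using mult_right_mono[of 2 "real L" "real L"] assms(1) by (simp add: power2_eq_square)
  \<comment> \<open>A state with a nonzero exit rate lies in the inner boundary, so all other states
    carry no flow.\<close>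
  have "(\<Sum>I\<in>?S. ?flow I) = (\<Sum>I\<in>?B. ?flow I)"
  proof (rule sum.mono_neutral_right[OF fin])
    show "?B \<subseteq> ?S" by (auto simp: inner_boundary_def)
    show "\<forall>I\<in>?S - ?B. ?flow I = 0"
      using even_basin_exit(4)[OF assms(2)] by (intro ballI sum.neutral) fastforce
  qed
  also have "\<dots> \<le> (\<Sum>I\<in>?B. ?d * (?E / \<sigma> ^ L))"
    by (rule sum_mono) (rule boundary_flow_le[OF assms(2,3)])
  also have "\<dots> = (real (card ?B) * ?d / \<sigma> ^ L) * ?E"
    by simp
  \<comment> \<open>\<open>?E\<close> is one term of the basin's mass; the prefactor is nonnegative
    by \<open>d\<close>.\<close>
  also have "\<dots> \<le> (real (card ?B) * ?d / \<sigma> ^ L) * (\<Sum>I\<in>?S. stationary L \<sigma> I)"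
    using d assms(3) fin even_vertices_in_even_basin[OF assms(2)]
    by (intro mult_left_mono member_le_sum) (auto intro: less_imp_le stationary_pos)
  finally have "(\<Sum>I\<in>?S. ?flow I) \<le> (real (card ?B) * ?d / \<sigma> ^ L) * (\<Sum>I\<in>?S. stationary L \<sigma> I)" .
  moreover have "(\<Sum>I\<in>?S. stationary L \<sigma> I) > 0"
    using even_vertices_in_even_basin[OF assms(2)] stationary_pos[OF assms(3)] fin
    by (intro sum_pos) auto
  ultimately show ?thesis
    unfolding conductance_def by (simp only: pos_divide_le_eq)
qed

end
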